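(* Let $N$ and $d$ be two positive integers and assume that $d$ divides $N$. Then the trigonometric cyclic polytope $$TC(N,2d)=\mathrm{conv}\{M(2\pi x/N):x=0,1,\dots,N-1\}\subset\mathbb R^{2d},\qquad M(\theta)=(\cos\theta,\sin\theta,\cos2\theta,\sin2\theta,\dots,\cos d\theta,\sin d\theta),$$ has a Hermitian positive semidefinite lift of size at most $3d\log_2(N/d)$.
   Context: A polytope $P\subset\mathbb R^m$ has a Hermitian positive semidefinite lift of size $k$ if there exist a (real-)linear map $\pi:\mathbf H^k\to\mathbb R^m$ and a (real) affine subspace $L\subset\mathbf H^k$ such that $P=\pi(\mathbf H^k_+\cap L)$, where $\mathbf H^k$ is the real vector space of $k\times k$ complex Hermitian matrices and $\mathbf H^k_+$ is the cone of positive semidefinite ones.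
   Formalization: The case N = d is excluded (d < N is assumed): there the bound 3d log_2(N/d) is 0, and a lift of size 0 has image at most {0}, while TC(d,2d) contains M(0), whose first coordinate is 1, so the claim fails for every N = d. *)

theory Defs
  imports "HOL-Analysis.Analysis" "Jordan_Normal_Form.Schur_Decomposition"
begin

definition hermitian_mats :: "nat \<Rightarrow> complex mat set" where
  "hermitian_mats k = {A \<in> carrier_mat k k. mat_adjoint A = A}"

definition psd_mats :: "nat \<Rightarrow> complex mat set" where
  "psd_mats k = {A \<in> hermitian_mats k. \<forall>v \<in> carrier_vec k. 0 \<le> Re ((A *\<^sub>v v) \<bullet>c v)}"

text \<open>
  The type \<^typ>\<open>complex mat\<close> contains matrices of all dimensions and is not a
  vector space, so linear maps on and affine subspaces of the real vector space of Hermitian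
  \<open>k \<times> k\<close> matrices are described relative to that carrier. Scalars are real.
\<close>

definition real_linear_on_hermitian :: "nat \<Rightarrow> (complex mat \<Rightarrow> 'a::real_vector) \<Rightarrow> bool" where
  "real_linear_on_hermitian k \<pi> \<longleftrightarrow>
     (\<forall>A \<in> hermitian_mats k. \<forall>B \<in> hermitian_mats k. \<pi> (A + B) = \<pi> A + \<pi> B) \<and>
     (\<forall>A \<in> hermitian_mats k. \<forall>c::real. \<pi> (complex_of_real c \<cdot>\<^sub>m A) = c *\<^sub>R \<pi> A)"

definition hermitian_affine :: "nat \<Rightarrow> complex mat set \<Rightarrow> bool" where
  "hermitian_affine k L \<longleftrightarrow>
     L \<subseteq> hermitian_mats k \<and>
     (\<forall>A \<in> L. \<forall>B \<in> L. \<forall>u v::real. u + v = 1 \<longrightarrow>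
        complex_of_real u \<cdot>\<^sub>m A + complex_of_real v \<cdot>\<^sub>m B \<in> L)"

definition has_hermitian_psd_lift :: "nat \<Rightarrow> 'a::euclidean_space set \<Rightarrow> bool" where
  "has_hermitian_psd_lift k P \<longleftrightarrow>
     (\<exists>\<pi> L. real_linear_on_hermitian k \<pi> \<and> hermitian_affine k L \<and> P = \<pi> ` (psd_mats k \<inter> L))"

text \<open>
  A linearly ordered finite index type \<open>'n\<close> with \<open>2d\<close> elements stands for the
  coordinates \<open>1 < 2 < \<dots> < 2d\<close>; \<open>coord_pos\<close> is the position counted from 0.
  So the type determines \<open>d\<close>, and positions \<open>2j\<close> and \<open>2j + 1\<close>
  of the moment vector hold the cosine and sine of \<open>(j + 1) \<theta>\<close>.
\<close>

definition coord_pos :: "'n::{finite,linorder} \<Rightarrow> nat" where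
  "coord_pos i = card {j. j < i}"

definition trig_moment :: "real \<Rightarrow> real ^ 'n::{finite,linorder}" where
  "trig_moment \<theta> =
     (\<chi> i. let t = real (coord_pos i div 2 + 1) * \<theta>
           in if even (coord_pos i) then cos t else sin t)"

definition trig_cyclic_polytope :: "nat \<Rightarrow> (real ^ 'n::{finite,linorder}) set" where
  "trig_cyclic_polytope N = convex hull ((\<lambda>x. trig_moment (2 * pi * real x / real N)) ` {0..<N})"

end

theory Submission
  imports Defs
begin

text \<open>
  Put \<open>n = N / d\<close>. The lift consists of the positive semidefinite matrices with entries
  \<open>\<gamma> (t a - t b)\<close>, where \<open>\<gamma>\<close> is \<open>N\<close>-periodic with \<open>\<gamma> 0 = 1\<close> and \<open>t\<close> runs through at most
  \<open>3 log n\<close> blocks of \<open>d\<close> consecutive integers; the moments \<open>\<gamma> 1, \<dots>, \<gamma> d\<close> are read off. The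
  blocks are chosen such that all triangles of some triangulation of the \<open>n\<close>-gon translate into
  them. Gluing positive semidefinite kernels along the diagonals of this triangulation completes
  \<open>\<gamma> (i - j)\<close>, prescribed for \<open>i, j\<close> in equal or cyclically adjacent blocks, to a positive
  semidefinite kernel on all residues modulo \<open>N\<close>. Averaging it over the cyclic group and taking the
  Fourier transform gives a probability measure on the \<open>N\<close> nodes whose moments of order at most
  \<open>d\<close> are those of \<open>\<gamma>\<close>.
\<close>

section \<open>Positive semidefinite kernels\<close>

text \<open>With \<open>A i j\<close> read as the inner product of vectors \<open>i\<close> and
  \<open>j\<close>, this is the inner product of two linear combinations of them; hence it is linear
  in \<open>x\<close> and conjugate linear in \<open>y\<close>.\<close>

definition kernel_form :: "'a set \<Rightarrow> ('a \<Rightarrow> 'a \<Rightarrow> complex) \<Rightarrow> ('a \<Rightarrow> complex) \<Rightarrow> ('a \<Rightarrow> complex) \<Rightarrow> complex"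
  where "kernel_form V A x y = (\<Sum>i\<in>V. \<Sum>j\<in>V. x i * A i j * cnj (y j))"

definition psd_kernel :: "'a set \<Rightarrow> ('a \<Rightarrow> 'a \<Rightarrow> complex) \<Rightarrow> bool"
  where "psd_kernel V A \<longleftrightarrow>
    (\<forall>i\<in>V. \<forall>j\<in>V. A j i = cnj (A i j)) \<and> (\<forall>x. 0 \<le> Re (kernel_form V A x x))"

definition unit_fun :: "'a \<Rightarrow> 'a \<Rightarrow> complex"
  where "unit_fun i = (\<lambda>j. of_bool (j = i))"

section \<open>Sesquilinear calculus and unit vectors\<close>

lemma kernel_form_add_left:
  "kernel_form V A (\<lambda>i. x i + y i) z = kernel_form V A x z + kernel_form V A y z"
  by (simp add: kernel_form_def algebra_simps sum.distrib)

lemma kernel_form_diff_left: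
  "kernel_form V A (\<lambda>i. x i - y i) z = kernel_form V A x z - kernel_form V A y z"
  by (simp add: kernel_form_def algebra_simps sum_subtractf)

lemma kernel_form_scale_left:
  "kernel_form V A (\<lambda>i. c * x i) z = c * kernel_form V A x z"
  by (simp add: kernel_form_def algebra_simps sum_distrib_left)

lemma kernel_form_add_right:
  "kernel_form V A z (\<lambda>i. x i + y i) = kernel_form V A z x + kernel_form V A z y"
  by (simp add: kernel_form_def algebra_simps sum.distrib)

lemma kernel_form_diff_right:
  "kernel_form V A z (\<lambda>i. x i - y i) = kernel_form V A z x - kernel_form V A z y"
  by (simp add: kernel_form_def algebra_simps sum_subtractf)

lemma kernel_form_scale_right:
  "kernel_form V A z (\<lambda>i. c * x i) = cnj c * kernel_form V A z x"
  by (simp add: kernel_form_def algebra_simps sum_distrib_left)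

lemma kernel_form_sum_left:
  "kernel_form V A (\<lambda>i. \<Sum>u\<in>U. f u * b u i) z = (\<Sum>u\<in>U. f u * kernel_form V A (b u) z)"
proof (induction U rule: infinite_finite_induct)
  case (insert u F)
  then show ?case
    by (simp add: kernel_form_add_left kernel_form_scale_left)
qed (simp_all add: kernel_form_def)

lemma kernel_form_sum_right:
  "kernel_form V A z (\<lambda>i. \<Sum>u\<in>U. f u * b u i) = (\<Sum>u\<in>U. cnj (f u) * kernel_form V A z (b u))"
proof (induction U rule: infinite_finite_induct)
  case (insert u F)
  then show ?case
    by (simp add: kernel_form_add_right kernel_form_scale_right)
qed (simp_all add: kernel_form_def)

lemma sum_unit_fun:
  assumes "finite V" "i \<in> V"
  shows "(\<Sum>j\<in>V. unit_fun i j * f j) = f i"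
proof -
  have "(\<Sum>j\<in>V. unit_fun i j * f j) = (\<Sum>j\<in>V. if j = i then f j else 0)"
    by (intro sum.cong) (auto simp: unit_fun_def)
  then show ?thesis using assms by simp
qed

lemma cnj_unit_fun [simp]: "cnj (unit_fun i j) = unit_fun i j"
  by (simp add: unit_fun_def)

lemma kernel_form_unit:
  assumes "finite V" "i \<in> V" "j \<in> V"
  shows "kernel_form V A (unit_fun i) (unit_fun j) = A i j"
proof -
  have "kernel_form V A (unit_fun i) (unit_fun j)
      = (\<Sum>k\<in>V. unit_fun i k * (\<Sum>l\<in>V. unit_fun j l * A k l))"
    unfolding kernel_form_def by (simp add: sum_distrib_left mult_ac)
  then show ?thesis using assms by (simp add: sum_unit_fun)
qed

lemma kernel_form_cong:
  assumes "\<And>i j. i \<in> V \<Longrightarrow> j \<in> V \<Longrightarrow> A i j = B i j"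
  shows "kernel_form V A x y = kernel_form V B x y"
  using assms by (simp add: kernel_form_def)

lemma psd_kernel_cong:
  assumes "\<And>i j. i \<in> V \<Longrightarrow> j \<in> V \<Longrightarrow> A i j = B i j"
  shows "psd_kernel V A \<longleftrightarrow> psd_kernel V B"
proof -
  have "kernel_form V A x x = kernel_form V B x x" for x
    by (rule kernel_form_cong) (rule assms)
  then show ?thesis
    unfolding psd_kernel_def by (simp only: assms cong: ball_cong)
qed

lemma kernel_form_mono_neutral:
  assumes "finite W" "K \<subseteq> W" "\<And>i. i \<in> W - K \<Longrightarrow> x i = 0" "\<And>i. i \<in> W - K \<Longrightarrow> y i = 0"
  shows "kernel_form W A x y = kernel_form K A x y"
proof -
  have "(\<Sum>j\<in>W. x i * A i j * cnj (y j)) = (\<Sum>j\<in>K. x i * A i j * cnj (y j))" for i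
    by (rule sum.mono_neutral_right) (use assms in auto)
  then have "kernel_form W A x y = (\<Sum>i\<in>W. \<Sum>j\<in>K. x i * A i j * cnj (y j))"
    by (simp add: kernel_form_def)
  also have "\<dots> = kernel_form K A x y"
    unfolding kernel_form_def by (rule sum.mono_neutral_right) (use assms in auto)
  finally show ?thesis .
qed

section \<open>Null vectors and constructions of positive semidefinite kernels\<close>

lemma psd_kernel_nonneg: "psd_kernel V A \<Longrightarrow> 0 \<le> Re (kernel_form V A x x)"
  by (simp add: psd_kernel_def)

lemma psd_kernel_hermitian:
  "psd_kernel V A \<Longrightarrow> i \<in> V \<Longrightarrow> j \<in> V \<Longrightarrow> A j i = cnj (A i j)"
  unfolding psd_kernel_def by blast

lemma psd_kernel_cnj:
  assumes "psd_kernel V A"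
  shows "cnj (kernel_form V A x y) = kernel_form V A y x"
proof -
  have "cnj (kernel_form V A x y) = (\<Sum>i\<in>V. \<Sum>j\<in>V. y j * A j i * cnj (x i))"
    unfolding kernel_form_def cnj_sum
    by (intro sum.cong refl)
      (simp only: psd_kernel_hermitian[OF assms, symmetric] complex_cnj_mult complex_cnj_cnj mult_ac)
  also have "\<dots> = kernel_form V A y x"
    unfolding kernel_form_def by (rule sum.swap)
  finally show ?thesis .
qed

text \<open>Moving \<open>y\<close> along a null vector \<open>v\<close> changes the quadratic form
  only linearly, so a nonzero product of \<open>y\<close> and \<open>v\<close> would eventually make
  it negative.\<close>

lemma psd_kernel_null_orthogonal:
  assumes "psd_kernel V A" and null: "kernel_form V A v v = 0"
  shows "kernel_form V A y v = 0"
proof (rule ccontr)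
  let ?F = "kernel_form V A"
  define w where "w = ?F y v"
  assume "?F y v \<noteq> 0"
  then have pos: "(cmod w)\<^sup>2 > 0" by (simp add: w_def)
  have vy: "?F v y = cnj w"
    using psd_kernel_cnj[OF assms(1), of y v] by (simp add: w_def)
  have ww: "w * cnj w = complex_of_real ((cmod w)\<^sup>2)"
    using complex_norm_square[of w] by simp
  have bound: "2 * s * (cmod w)\<^sup>2 \<le> Re (?F y y)" for s :: real
  proof -
    define t where "t = - (complex_of_real s * w)"
    have "?F (\<lambda>i. y i + t * v i) (\<lambda>i. y i + t * v i) = ?F y y + cnj t * w + t * cnj w"
      by (simp add: kernel_form_add_left kernel_form_add_right kernel_form_scale_left
          kernel_form_scale_right null vy w_def[symmetric])
    also have "\<dots> = ?F y y - complex_of_real (2 * s) * (w * cnj w)"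
      by (simp add: t_def algebra_simps)
    also have "\<dots> = ?F y y - complex_of_real (2 * s * (cmod w)\<^sup>2)"
      by (simp only: ww of_real_mult)
    finally have "Re (?F (\<lambda>i. y i + t * v i) (\<lambda>i. y i + t * v i)) = Re (?F y y) - 2 * s * (cmod w)\<^sup>2"
      by simp
    then show ?thesis
      using psd_kernel_nonneg[OF assms(1), of "\<lambda>i. y i + t * v i"] by simp
  qed
  \<comment> \<open>This value of \<open>s\<close> makes the left side of \<open>bound\<close>
    exceed the right side by 1.\<close>
  have "2 * ((Re (?F y y) + 1) / (2 * (cmod w)\<^sup>2)) * (cmod w)\<^sup>2 = Re (?F y y) + 1"
    using pos by (simp add: field_simps)
  with bound[of "(Re (?F y y) + 1) / (2 * (cmod w)\<^sup>2)"] show False by simp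
qed

text \<open>A Gram kernel of vectors \<open>b i\<close>: its quadratic form at \<open>x\<close> is
  that of \<open>A\<close> at the combination of the \<open>b i\<close> with coefficients
  \<open>x i\<close>.\<close>

lemma psd_kernel_linear_pullback:
  assumes "psd_kernel V A"
  shows "psd_kernel U (\<lambda>i j. kernel_form V A (b i) (b j))"
proof -
  have "kernel_form U (\<lambda>i j. kernel_form V A (b i) (b j)) x x
      = kernel_form V A (\<lambda>k. \<Sum>u\<in>U. x u * b u k) (\<lambda>k. \<Sum>u\<in>U. x u * b u k)" for x
    unfolding kernel_form_sum_left kernel_form_sum_right
    by (simp add: kernel_form_def[of U] sum_distrib_left mult_ac)
  then show ?thesis
    using psd_kernel_nonneg[OF assms] by (simp add: psd_kernel_def psd_kernel_cnj[OF assms])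
qed

text \<open>Reindexing is the Gram kernel of unit vectors. Since \<open>\<phi>\<close> may repeat
  indices, several integers can later be represented by one row of a matrix.\<close>

lemma psd_kernel_pullback:
  assumes "psd_kernel V A" "finite V" "\<And>i. i \<in> U \<Longrightarrow> \<phi> i \<in> V"
  shows "psd_kernel U (\<lambda>i j. A (\<phi> i) (\<phi> j))"
proof -
  have "psd_kernel U (\<lambda>i j. kernel_form V A (unit_fun (\<phi> i)) (unit_fun (\<phi> j)))"
    by (rule psd_kernel_linear_pullback[OF assms(1)])
  then show ?thesis
    by (subst psd_kernel_cong[of _ _ "\<lambda>i j. kernel_form V A (unit_fun (\<phi> i)) (unit_fun (\<phi> j))"])
      (use assms in \<open>auto simp: kernel_form_unit\<close>)
qed

lemma psd_kernel_subset:
  assumes "psd_kernel V A" "finite V" "U \<subseteq> V"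
  shows "psd_kernel U A"
  using psd_kernel_pullback[OF assms(1,2), of U "\<lambda>i. i"] assms(3) by blast

lemma psd_kernel_add:
  assumes "psd_kernel V A" "psd_kernel V B"
  shows "psd_kernel V (\<lambda>i j. A i j + B i j)"
proof -
  have "kernel_form V (\<lambda>i j. A i j + B i j) x x = kernel_form V A x x + kernel_form V B x x" for x
    by (simp add: kernel_form_def algebra_simps sum.distrib)
  moreover have "A j i + B j i = cnj (A i j + B i j)" if "i \<in> V" "j \<in> V" for i j
    using psd_kernel_hermitian[OF assms(1) that] psd_kernel_hermitian[OF assms(2) that]
    by (simp only: complex_cnj_add)
  ultimately show ?thesis
    using assms[THEN psd_kernel_nonneg] by (simp add: psd_kernel_def)
qed

lemma psd_kernel_scale:
  assumes A: "psd_kernel V A" and "0 \<le> w"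
  shows "psd_kernel V (\<lambda>i j. complex_of_real w * A i j)"
proof -
  have "kernel_form V (\<lambda>i j. complex_of_real w * A i j) x x = of_real w * kernel_form V A x x" for x
    by (simp add: kernel_form_def sum_distrib_left mult_ac)
  moreover have "of_real w * A j i = cnj (of_real w * A i j)" if "i \<in> V" "j \<in> V" for i j
    using psd_kernel_hermitian[OF A that] by (simp only: complex_cnj_mult complex_cnj_complex_of_real)
  ultimately show ?thesis
    using psd_kernel_nonneg[OF A] assms(2) by (simp add: psd_kernel_def)
qed

section \<open>Orthogonal projection and gluing\<close>

lemma kernel_form_orthogonal_support:
  assumes "finite V" "K \<subseteq> V" "\<And>k. k \<in> K \<Longrightarrow> kernel_form V A x (unit_fun k) = 0"
    and "\<And>i. i \<notin> K \<Longrightarrow> p i = 0"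
  shows "kernel_form V A x p = 0"
proof -
  have fin: "finite K" using assms finite_subset by blast
  have p: "p = (\<lambda>i. \<Sum>k\<in>K. p k * unit_fun k i)"
  proof
    fix i
    have "(\<Sum>k\<in>K. p k * unit_fun k i) = (\<Sum>k\<in>K. if i = k then p k else 0)"
      by (intro sum.cong) (auto simp: unit_fun_def)
    also have "\<dots> = p i"
      using fin assms(4)[of i] by (simp add: sum.delta)
    finally show "p i = (\<Sum>k\<in>K. p k * unit_fun k i)" by simp
  qed
  show ?thesis
    by (subst p, subst kernel_form_sum_right) (simp add: assms(3))
qed

text \<open>Gram-Schmidt, one index of \<open>K\<close> at a time. The projection \<open>a\<close>
  of \<open>x\<close> onto the span of \<open>K\<close> need not be unique, as the form may be
  degenerate.\<close>

lemma psd_kernel_projection: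
  assumes "psd_kernel V A" "finite V" "K \<subseteq> V"
  shows "\<exists>a. (\<forall>i. i \<notin> K \<longrightarrow> a i = 0) \<and>
             (\<forall>k\<in>K. kernel_form V A (\<lambda>i. x i - a i) (unit_fun k) = 0)"
proof -
  have "finite K" using assms finite_subset by blast
  then show ?thesis using assms(3)
  proof (induction K arbitrary: x)
    case empty
    then show ?case by (intro exI[of _ "\<lambda>_. 0"]) simp
  next
    case (insert u K)
    let ?F = "kernel_form V A"
    obtain a where a: "\<And>i. i \<notin> K \<Longrightarrow> a i = 0" "\<And>k. k \<in> K \<Longrightarrow> ?F (\<lambda>i. x i - a i) (unit_fun k) = 0"
      using insert.IH[of x] insert.prems by auto
    obtain p where p: "\<And>i. i \<notin> K \<Longrightarrow> p i = 0"
      "\<And>k. k \<in> K \<Longrightarrow> ?F (\<lambda>i. unit_fun u i - p i) (unit_fun k) = 0"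
      using insert.IH[of "unit_fun u"] insert.prems by auto
    \<comment> \<open>The part of the new unit vector that is orthogonal to the old ones.\<close>
    define v where "v = (\<lambda>i. unit_fun u i - p i)"
    have u: "unit_fun u = (\<lambda>i. v i + p i)" by (simp add: v_def)
    have KV: "K \<subseteq> V" using insert.prems by auto
    \<comment> \<open>This coefficient makes the new residual orthogonal to \<open>v\<close>. If
      \<open>v\<close> is a null vector, division by zero gives \<open>c = 0\<close> and
      orthogonality to \<open>v\<close> is automatic.\<close>
    define c where "c = ?F (\<lambda>i. x i - a i) v / ?F v v"
    define a' where "a' = (\<lambda>i. a i + c * v i)"
    have diff: "(\<lambda>i. x i - a' i) = (\<lambda>i. (x i - a i) - c * v i)"
      by (auto simp: a'_def)
    have "?F (\<lambda>i. x i - a' i) v = 0"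
    proof (cases "?F v v = 0")
      case True
      then show ?thesis
        using psd_kernel_null_orthogonal[OF assms(1)] by blast
    next
      case False
      then show ?thesis
        unfolding diff kernel_form_diff_left[of V A "\<lambda>i. x i - a i"] kernel_form_scale_left
        by (simp add: c_def)
    qed
    moreover have K: "?F (\<lambda>i. x i - a' i) (unit_fun k) = 0" if "k \<in> K" for k
      using a(2)[OF that] p(2)[OF that]
      unfolding diff kernel_form_diff_left[of V A "\<lambda>i. x i - a i"] kernel_form_scale_left v_def
      by simp
    moreover have "?F (\<lambda>i. x i - a' i) p = 0"
      by (rule kernel_form_orthogonal_support[OF assms(2) KV K p(1)])
    ultimately have "?F (\<lambda>i. x i - a' i) (unit_fun u) = 0"
      by (simp add: u kernel_form_add_right)
    moreover have "a' i = 0" if "i \<notin> insert u K" for i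
      using that a(1) p(1) by (auto simp: a'_def v_def unit_fun_def)
    ultimately show ?case using K by blast
  qed
qed

text \<open>The glued kernel places each index of \<open>V - W\<close> at its \<open>A\<close>-orthogonal projection \<open>a i\<close> onto
  the span of \<open>V \<inter> W\<close>, and adds the Gram kernel of the orthogonal complements \<open>b i\<close>.\<close>

lemma psd_kernel_glue:
  assumes A: "psd_kernel V A" and B: "psd_kernel W B" and fin: "finite V" "finite W"
    and agree: "\<And>i j. i \<in> V \<inter> W \<Longrightarrow> j \<in> V \<inter> W \<Longrightarrow> A i j = B i j"
  obtains C where "psd_kernel (V \<union> W) C"
    and "\<And>i j. i \<in> V \<Longrightarrow> j \<in> V \<Longrightarrow> C i j = A i j"
    and "\<And>i j. i \<in> W \<Longrightarrow> j \<in> W \<Longrightarrow> C i j = B i j"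
proof -
  let ?F = "kernel_form V A"
  let ?K = "V \<inter> W"
  have "\<exists>p. (\<forall>j. j \<notin> ?K \<longrightarrow> p j = 0) \<and>
             (\<forall>k\<in>?K. ?F (\<lambda>j. unit_fun i j - p j) (unit_fun k) = 0)" for i
    by (rule psd_kernel_projection[OF A fin(1)]) simp
  then obtain a0 where "\<forall>i. (\<forall>j. j \<notin> ?K \<longrightarrow> a0 i j = 0) \<and>
             (\<forall>k\<in>?K. ?F (\<lambda>j. unit_fun i j - a0 i j) (unit_fun k) = 0)"
    by (atomize_elim, intro choice allI)
  then have a0: "\<And>i j. j \<notin> ?K \<Longrightarrow> a0 i j = 0"
    "\<And>i k. k \<in> ?K \<Longrightarrow> ?F (\<lambda>j. unit_fun i j - a0 i j) (unit_fun k) = 0"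
    by blast+
  \<comment> \<open>On \<open>W\<close> the unit vector is kept, so \<open>b\<close> vanishes there
    and \<open>C\<close> restricts to \<open>B\<close>.\<close>
  define a where "a = (\<lambda>i. if i \<in> W then unit_fun i else a0 i)"
  define b where "b = (\<lambda>i j. unit_fun i j - a i j)"
  define C where "C = (\<lambda>i j. kernel_form W B (a i) (a j) + ?F (b i) (b j))"
  have supp: "a i j = 0" if "i \<in> V" "j \<notin> ?K" for i j
    using that a0(1) by (auto simp: a_def unit_fun_def)
  have orth: "?F (b i) (unit_fun k) = 0" if "k \<in> ?K" for i k
    using a0(2)[OF that] by (auto simp: b_def a_def kernel_form_def)
  have ba: "?F (b i) (a j) = 0" if "j \<in> V" for i j
    by (rule kernel_form_orthogonal_support[OF fin(1), of ?K]) (use that supp orth in auto)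
  have ab: "?F (a j) (b i) = 0" if "j \<in> V" for i j
    using psd_kernel_cnj[OF A, of "b i" "a j"] ba[OF that] by simp
  have "psd_kernel (V \<union> W) C"
    unfolding C_def by (intro psd_kernel_add psd_kernel_linear_pullback A B)
  moreover have "C i j = A i j" if "i \<in> V" "j \<in> V" for i j
  proof -
    \<comment> \<open>By \<open>supp\<close> both vectors live on \<open>V \<inter> W\<close>, where
      the two kernels agree, so this part of \<open>C\<close> can be computed with
      \<open>A\<close>.\<close>
    have "kernel_form W B (a i) (a j) = kernel_form ?K B (a i) (a j)"
      by (rule kernel_form_mono_neutral) (use that fin supp in auto)
    also have "\<dots> = kernel_form ?K A (a i) (a j)"
      by (rule kernel_form_cong) (simp add: agree)
    also have "\<dots> = ?F (a i) (a j)"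
      by (rule kernel_form_mono_neutral[symmetric]) (use that fin supp in auto)
    finally have "C i j = ?F (a i) (a j) + ?F (b i) (b j)" by (simp add: C_def)
    also have "\<dots> = ?F (\<lambda>k. a i k + b i k) (\<lambda>k. a j k + b j k)"
      by (simp add: kernel_form_add_left kernel_form_add_right ab[OF that(1)] ba[OF that(2)])
    also have "\<dots> = A i j"
      using kernel_form_unit[OF fin(1) that] by (simp add: b_def)
    finally show ?thesis .
  qed
  moreover have "C i j = B i j" if "i \<in> W" "j \<in> W" for i j
  proof -
    have "b i = (\<lambda>_. 0)" using that by (simp add: b_def a_def)
    then show ?thesis
      using that fin by (simp add: C_def a_def kernel_form_unit) (simp add: kernel_form_def)
  qed
  ultimately show ?thesis using that by blast
qed

section \<open>Completion along a triangulated polygon\<close>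

definition block_union :: "nat \<Rightarrow> int set \<Rightarrow> int set"
  where "block_union d S = {i. i div int d \<in> S}"

text \<open>The blocks \<open>0..m\<close> are the vertices of a polygon. The entries are prescribed
  within each vertex and along each edge, including the closing edge between \<open>0\<close> and
  \<open>m\<close>; those on diagonals are free.\<close>

definition block_completion :: "nat \<Rightarrow> (int \<Rightarrow> complex) \<Rightarrow> int \<Rightarrow> (int \<Rightarrow> int \<Rightarrow> complex) \<Rightarrow> bool"
  where "block_completion d \<gamma> m C \<longleftrightarrow> psd_kernel (block_union d {0..m}) C \<and>
    (\<forall>i\<in>block_union d {0..m}. \<forall>j\<in>block_union d {0..m}.
      \<bar>i div int d - j div int d\<bar> \<le> 1 \<or> {i div int d, j div int d} \<subseteq> {0, m}
      \<longrightarrow> C i j = \<gamma> (i - j))"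

lemma finite_block_union:
  assumes "0 < d" "finite S"
  shows "finite (block_union d S)"
proof -
  have "block_union d S \<subseteq> (\<Union>s\<in>S. (\<lambda>r. s * int d + r) ` {0..<int d})"
  proof
    fix i assume "i \<in> block_union d S"
    then have "i div int d \<in> S" by (simp add: block_union_def)
    moreover have "i = i div int d * int d + i mod int d" by simp
    moreover have "i mod int d \<in> {0..<int d}" using assms by simp
    ultimately show "i \<in> (\<Union>s\<in>S. (\<lambda>r. s * int d + r) ` {0..<int d})" by blast
  qed
  then show ?thesis using assms(2) by (meson finite_UN_I finite_imageI finite_atLeastLessThan_int finite_subset)
qed

lemma block_completion_one:
  assumes "psd_kernel (block_union d {0, 1}) (\<lambda>i j. \<gamma> (i - j))"
  shows "\<exists>C. block_completion d \<gamma> 1 C"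
proof -
  have "{0..1::int} = {0, 1}" by auto
  then show ?thesis
    using assms by (intro exI[of _ "\<lambda>i j. \<gamma> (i - j)"]) (simp add: block_completion_def)
qed

text \<open>The triangle on the blocks \<open>0\<close>, \<open>a\<close>, \<open>a + b\<close>
  separates the polygons on \<open>0..a\<close> and \<open>a..a + b\<close>; their closing edges are
  the sides along which the kernels are glued. The data depend on differences only, so the second
  polygon may be translated.\<close>

lemma block_completion_add:
  assumes "0 < d" "1 \<le> a" "1 \<le> b"
    and A: "block_completion d \<gamma> a A" and B: "block_completion d \<gamma> b B"
    and tri: "psd_kernel (block_union d {0, a, a + b}) (\<lambda>i j. \<gamma> (i - j))"
  shows "\<exists>C. block_completion d \<gamma> (a + b) C"
proof -
  define q where "q i = i div int d" for i
  have mem: "i \<in> block_union d S \<longleftrightarrow> q i \<in> S" for i S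
    by (simp add: block_union_def q_def)
  have q_shift: "q (i - a * int d) = q i - a" for i
    using assms(1) div_mult_self1[of "int d" i "- a"] by (simp add: q_def)
  let ?V = "block_union d {0..a}" and ?T = "block_union d {0, a, a + b}"
    and ?W = "block_union d {a..a + b}" and ?U = "block_union d {0..a + b}"
  define B' where "B' = (\<lambda>i j. B (i - a * int d) (j - a * int d))"
  have psdA: "psd_kernel ?V A"
    and valA: "\<And>i j. q i \<in> {0..a} \<Longrightarrow> q j \<in> {0..a} \<Longrightarrow>
      \<bar>q i - q j\<bar> \<le> 1 \<or> q i \<in> {0, a} \<and> q j \<in> {0, a} \<Longrightarrow> A i j = \<gamma> (i - j)"
    using A by (auto simp: block_completion_def mem q_def[symmetric])
  have psdB: "psd_kernel (block_union d {0..b}) B"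
    and valB: "\<And>i j. q i \<in> {0..b} \<Longrightarrow> q j \<in> {0..b} \<Longrightarrow>
      \<bar>q i - q j\<bar> \<le> 1 \<or> q i \<in> {0, b} \<and> q j \<in> {0, b} \<Longrightarrow> B i j = \<gamma> (i - j)"
    using B by (auto simp: block_completion_def mem q_def[symmetric])
  have psdB': "psd_kernel ?W B'"
    unfolding B'_def
    by (rule psd_kernel_pullback[OF psdB finite_block_union[OF assms(1)]]) (auto simp: mem q_shift)
  have valB': "B' i j = \<gamma> (i - j)" if "q i \<in> {a..a + b}" "q j \<in> {a..a + b}"
    "\<bar>q i - q j\<bar> \<le> 1 \<or> q i \<in> {a, a + b} \<and> q j \<in> {a, a + b}" for i j
    using that valB[of "i - a * int d" "j - a * int d"] by (auto simp: B'_def q_shift)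
  \<comment> \<open>The overlap consists of the blocks \<open>0\<close> and \<open>a\<close>, the
    closing edge of the first polygon.\<close>
  obtain C where C: "psd_kernel (?V \<union> ?T) C"
    "\<And>i j. i \<in> ?V \<Longrightarrow> j \<in> ?V \<Longrightarrow> C i j = A i j"
    "\<And>i j. i \<in> ?T \<Longrightarrow> j \<in> ?T \<Longrightarrow> C i j = \<gamma> (i - j)"
  proof (rule psd_kernel_glue[OF psdA tri])
    show "A i j = \<gamma> (i - j)" if "i \<in> ?V \<inter> ?T" "j \<in> ?V \<inter> ?T" for i j
    proof (rule valA)
      have "q i \<in> {0, a}" "q j \<in> {0, a}"
        using that assms(2,3) by (auto simp: mem)
      then show "q i \<in> {0..a}" "q j \<in> {0..a}"
        "\<bar>q i - q j\<bar> \<le> 1 \<or> q i \<in> {0, a} \<and> q j \<in> {0, a}"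
        using assms(2) by auto
    qed
  qed (use assms(1) in \<open>auto intro: finite_block_union\<close>)
  \<comment> \<open>Here the overlap consists of the blocks \<open>a\<close> and
    \<open>a + b\<close>, the closing edge of the translated polygon.\<close>
  obtain D where D: "psd_kernel ((?V \<union> ?T) \<union> ?W) D"
    "\<And>i j. i \<in> ?V \<union> ?T \<Longrightarrow> j \<in> ?V \<union> ?T \<Longrightarrow> D i j = C i j"
    "\<And>i j. i \<in> ?W \<Longrightarrow> j \<in> ?W \<Longrightarrow> D i j = B' i j"
  proof (rule psd_kernel_glue[OF C(1) psdB'])
    fix i j assume "i \<in> (?V \<union> ?T) \<inter> ?W" "j \<in> (?V \<union> ?T) \<inter> ?W"
    then have "q i \<in> {a, a + b}" "q j \<in> {a, a + b}"
      using assms(2,3) by (auto simp: mem)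
    then show "C i j = B' i j"
      using C(3)[of i j] valB'[of i j] assms(2,3) by (auto simp: mem)
  qed (use assms(1) in \<open>auto intro: finite_block_union\<close>)
  have "?V \<union> ?T \<union> ?W = ?U"
    using assms(2,3) by (auto simp: mem)
  then have "psd_kernel ?U D" using D(1) by simp
  moreover have "D i j = \<gamma> (i - j)"
    if ij: "q i \<in> {0..a + b}" "q j \<in> {0..a + b}"
      and near: "\<bar>q i - q j\<bar> \<le> 1 \<or> q i \<in> {0, a + b} \<and> q j \<in> {0, a + b}" for i j
  proof -
    \<comment> \<open>A prescribed pair lies on the new closing edge, which is a side of the
      triangle, or in neighbouring blocks, which cannot lie strictly on different sides of
      \<open>a\<close>.\<close>
    consider "q i \<in> {0, a + b} \<and> q j \<in> {0, a + b}"
      | "\<bar>q i - q j\<bar> \<le> 1" "q i \<in> {0..a}" "q j \<in> {0..a}"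
      | "\<bar>q i - q j\<bar> \<le> 1" "q i \<in> {a..a + b}" "q j \<in> {a..a + b}"
      using ij near by fastforce
    then show ?thesis
    proof cases
      case 1
      then show ?thesis using D(2)[of i j] C(3)[of i j] by (auto simp: mem)
    next
      case 2
      then show ?thesis using D(2)[of i j] C(2)[of i j] valA[of i j] by (auto simp: mem)
    next
      case 3
      then show ?thesis using D(3)[of i j] valB'[of i j] by (auto simp: mem)
    qed
  qed
  ultimately have "block_completion d \<gamma> (a + b) D"
    unfolding block_completion_def by (simp add: mem q_def[symmetric])
  then show ?thesis by blast
qed

section \<open>A triangulation with few triangles up to translation\<close>

text \<open>The triangles of a triangulation of the \<open>n\<close>-gon, up to translation: the chords of
  length \<open>2 ^ i\<close> are halved repeatedly, and \<open>n\<close> is peeled off bit by bit.\<close>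

definition clique_offsets :: "nat \<Rightarrow> int set"
  where "clique_offsets n = insert 0 ((\<lambda>i. 2 ^ i) ` {i. 2 ^ i \<le> n} \<union> (\<lambda>i. int (n mod 2 ^ i)) ` UNIV)"

text \<open>Doubling: two copies of the completion for \<open>2 ^ i\<close> are joined by the
  triangle \<open>0\<close>, \<open>2 ^ i\<close>, \<open>2 ^ Suc i\<close>.\<close>

lemma block_completion_pow2:
  assumes "0 < d"
    and psd: "\<And>a b. {a, b} \<subseteq> clique_offsets n \<Longrightarrow>
      psd_kernel (block_union d {0, a, b}) (\<lambda>i j. \<gamma> (i - j))"
  shows "2 ^ i \<le> n \<Longrightarrow> \<exists>C. block_completion d \<gamma> (2 ^ i) C"
proof (induction i)
  case 0
  \<comment> \<open>The single edge is the degenerate triangle with both offsets equal to 1.\<close>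
  have "psd_kernel (block_union d {0, 1, 1}) (\<lambda>i j. \<gamma> (i - j))"
    using 0 by (intro psd) (auto simp: clique_offsets_def intro!: image_eqI[of _ _ 0])
  then show ?case using block_completion_one by simp
next
  case (Suc i)
  then have le: "2 ^ i \<le> n" by simp
  then obtain C where C: "block_completion d \<gamma> (2 ^ i) C" using Suc.IH by blast
  have "(2::int) ^ i \<in> clique_offsets n" "(2::int) ^ Suc i \<in> clique_offsets n"
    using le Suc.prems unfolding clique_offsets_def by blast+
  then have "psd_kernel (block_union d {0, 2 ^ i, 2 ^ Suc i}) (\<lambda>i j. \<gamma> (i - j))"
    by (intro psd) auto
  moreover have double: "(2::int) ^ Suc i = 2 ^ i + 2 ^ i" by simp
  ultimately show ?case
    unfolding double by (intro block_completion_add[OF assms(1) _ _ C C]) auto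
qed

text \<open>Induction over the binary digits of \<open>n\<close> from the lowest one. A digit 1
  joins the polygons for \<open>2 ^ i\<close> and \<open>n mod 2 ^ i\<close> through one triangle; a
  digit 0 changes nothing.\<close>

lemma block_completion_mod_pow2:
  assumes "0 < d"
    and psd: "\<And>a b. {a, b} \<subseteq> clique_offsets n \<Longrightarrow>
      psd_kernel (block_union d {0, a, b}) (\<lambda>i j. \<gamma> (i - j))"
  shows "0 < n mod 2 ^ i \<Longrightarrow> \<exists>C. block_completion d \<gamma> (int (n mod 2 ^ i)) C"
proof (induction i)
  case (Suc i)
  let ?r = "n mod 2 ^ i"
  have cases: "n mod 2 ^ Suc i = ?r \<or> n mod 2 ^ Suc i = 2 ^ i + ?r"
    using mod_mult2_eq[of n "2 ^ i" 2] mod2_eq_if[of "n div 2 ^ i"]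
    by (auto simp: mult.commute split: if_splits)
  show ?case
  proof (cases "n mod 2 ^ Suc i = ?r")
    case True
    then show ?thesis using Suc by simp
  next
    case False
    then have eq: "n mod 2 ^ Suc i = 2 ^ i + ?r" using cases by blast
    then have le: "2 ^ i \<le> n" by (metis le_add1 le_trans mod_less_eq_dividend)
    obtain C where C: "block_completion d \<gamma> (2 ^ i) C"
      using block_completion_pow2[OF assms le] by blast
    show ?thesis
    proof (cases "?r = 0")
      case True
      then show ?thesis using C eq by auto
    next
      case False
      then obtain D where D: "block_completion d \<gamma> (int ?r) D" using Suc.IH by blast
      have "(2::int) ^ i \<in> clique_offsets n" "int (n mod 2 ^ Suc i) \<in> clique_offsets n"
        using le unfolding clique_offsets_def by blast+
      then have "psd_kernel (block_union d {0, 2 ^ i, int (n mod 2 ^ Suc i)}) (\<lambda>i j. \<gamma> (i - j))"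
        by (intro psd) auto
      moreover have sum: "int (n mod 2 ^ Suc i) = 2 ^ i + int ?r" by (simp only: eq) simp
      ultimately show ?thesis
        unfolding sum by (intro block_completion_add[OF assms(1) _ _ C D]) (use False in auto)
    qed
  qed
qed simp

lemma block_completion_exists:
  assumes "0 < d" "0 < n"
    and psd: "\<And>a b. {a, b} \<subseteq> clique_offsets n \<Longrightarrow>
      psd_kernel (block_union d {0, a, b}) (\<lambda>i j. \<gamma> (i - j))"
  shows "\<exists>C. block_completion d \<gamma> (int n) C"
proof -
  \<comment> \<open>Since \<open>n < 2 ^ n\<close>, the exponent \<open>n\<close> exhausts all
    binary digits.\<close>
  have "n mod 2 ^ n = n" by simp
  then show ?thesis
    using block_completion_mod_pow2[OF assms(1,3), of n n] assms(2) by simp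
qed

section \<open>Circulant averaging\<close>

definition root_char :: "nat \<Rightarrow> int \<Rightarrow> complex"
  where "root_char N m = cis (2 * pi * real_of_int m / real N)"

lemma root_char_0 [simp]: "root_char N 0 = 1"
  by (simp add: root_char_def)

lemma root_char_add: "root_char N (a + b) = root_char N a * root_char N b"
  by (simp add: root_char_def cis_mult distrib_left add_divide_distrib)

lemma root_char_uminus: "root_char N (- a) = cnj (root_char N a)"
  by (simp add: root_char_def cis_cnj)

lemma root_char_diff: "root_char N (a - b) = root_char N a * cnj (root_char N b)"
  using root_char_add[of N a "- b"] by (simp add: root_char_uminus)

lemma root_char_mult_nat: "root_char N (m * int x) = root_char N m ^ x"
  by (simp add: root_char_def Complex.DeMoivre mult_ac)

lemma root_char_eq_1_iff:
  assumes "0 < N"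
  shows "root_char N m = 1 \<longleftrightarrow> int N dvd m"
proof
  assume "root_char N m = 1"
  then have "cos (2 * pi * real_of_int m / real N) = 1"
    by (simp add: root_char_def complex_eq_iff)
  then obtain q :: int where "2 * pi * real_of_int m / real N = of_int q * 2 * pi"
    unfolding cos_one_2pi_int by blast
  then have "real_of_int m = real_of_int (q * int N)"
    using assms by (simp add: field_simps)
  then show "int N dvd m" by (metis dvd_triv_right of_int_eq_iff)
next
  assume "int N dvd m"
  then obtain q where "m = int N * q" by (rule dvdE)
  then have "2 * pi * real_of_int m / real N = 2 * pi * real_of_int q"
    using assms by simp
  then show "root_char N m = 1"
    by (simp add: root_char_def cis_multiple_2pi)
qed

lemma root_char_mod_cong:
  assumes "0 < N" "m mod int N = m' mod int N"
  shows "root_char N m = root_char N m'"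
proof -
  have "root_char N (m - m') = 1"
    using assms by (simp add: root_char_eq_1_iff mod_eq_dvd_iff)
  then show ?thesis
    using root_char_add[of N "m - m'" m'] by simp
qed

lemma sum_root_char:
  assumes "0 < N"
  shows "(\<Sum>x<N. root_char N (m * int x)) = (if int N dvd m then of_nat N else 0)"
proof (cases "int N dvd m")
  case True
  then have "root_char N m = 1" by (simp add: root_char_eq_1_iff[OF assms])
  then show ?thesis using True by (simp add: root_char_mult_nat)
next
  case False
  then have "root_char N m \<noteq> 1" by (simp add: root_char_eq_1_iff[OF assms])
  moreover have "root_char N m ^ N = 1"
    using root_char_mult_nat[of N m N] root_char_eq_1_iff[OF assms, of "m * int N"] by simp
  ultimately show ?thesis
    using False by (simp add: root_char_mult_nat geometric_sum)
qed

text \<open>The weight \<open>\<mu> x\<close> is a scaled value of the quadratic form of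
  \<open>X\<close> at a character, hence nonnegative; its Fourier coefficients are averages of
  \<open>X\<close> along cyclic diagonals. Only the diagonals \<open>0..d\<close> are assumed
  constant, and only their moments are recovered.\<close>

lemma circulant_average:
  assumes "0 < N"
    and psd: "psd_kernel {0..<int N} X"
    and X: "\<And>j k. j \<in> {0..<int N} \<Longrightarrow> k \<in> {0..int d} \<Longrightarrow> X ((j + k) mod int N) j = \<gamma> k"
    and "\<gamma> 0 = 1"
  obtains \<mu> :: "nat \<Rightarrow> real" where "\<And>x. 0 \<le> \<mu> x" "(\<Sum>x<N. \<mu> x) = 1"
    and "\<And>k. k \<in> {0..int d} \<Longrightarrow> (\<Sum>x<N. of_real (\<mu> x) * root_char N (k * int x)) = \<gamma> k"
proof -
  let ?I = "{0..<int N}"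
  define f where "f x = kernel_form ?I X (\<lambda>i. root_char N (- (i * int x))) (\<lambda>i. root_char N (- (i * int x)))" for x
  \<comment> \<open>One factor \<open>N\<close> cancels the orthogonality sum over \<open>x\<close>,
    the other the number of entries on a cyclic diagonal.\<close>
  define \<mu> where "\<mu> x = Re (f x) / (real N)\<^sup>2" for x
  have "cnj (f x) = f x" for x
    unfolding f_def by (rule psd_kernel_cnj[OF psd])
  then have f_real: "f x = of_real (Re (f x))" for x
    by (metis Reals_cnj_iff of_real_Re)
  have f_mu: "of_real (\<mu> x) = f x / (of_nat N)\<^sup>2" for x
    by (subst f_real) (simp add: \<mu>_def)
  have nonneg: "0 \<le> \<mu> x" for x
    unfolding \<mu>_def f_def using psd_kernel_nonneg[OF psd] by simp
  have moment: "(\<Sum>x<N. of_real (\<mu> x) * root_char N (k * int x)) = \<gamma> k" if k: "k \<in> {0..int d}" for k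
  proof -
    have fx: "f x * root_char N (k * int x) = (\<Sum>j\<in>?I. \<Sum>i\<in>?I. X i j * root_char N ((k - i + j) * int x))" for x
    proof -
      have e: "root_char N ((k - i + j) * int x)
        = root_char N (- (i * int x)) * cnj (root_char N (- (j * int x))) * root_char N (k * int x)" for i j
        unfolding root_char_diff[symmetric] root_char_add[symmetric] by (simp add: algebra_simps)
      have "f x * root_char N (k * int x) = (\<Sum>i\<in>?I. \<Sum>j\<in>?I. X i j * root_char N ((k - i + j) * int x))"
        unfolding f_def kernel_form_def sum_distrib_right e by (simp only: mult_ac)
      then show ?thesis by (subst sum.swap)
    qed
    \<comment> \<open>In each column \<open>j\<close>, orthogonality leaves only the row on the
      \<open>k\<close>-th cyclic diagonal.\<close>
    have inner: "(\<Sum>i\<in>?I. X i j * (if int N dvd k - i + j then of_nat N else 0)) = \<gamma> k * of_nat N"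
      if j: "j \<in> ?I" for j
    proof -
      have "(int N dvd k - i + j) \<longleftrightarrow> i = (j + k) mod int N" if "i \<in> ?I" for i
      proof -
        have "(int N dvd k - i + j) \<longleftrightarrow> (j + k) mod int N = i mod int N"
          by (simp add: mod_eq_dvd_iff algebra_simps)
        then show ?thesis using that by auto
      qed
      then have "(\<Sum>i\<in>?I. X i j * (if int N dvd k - i + j then of_nat N else 0))
          = (\<Sum>i\<in>?I. if i = (j + k) mod int N then X i j * of_nat N else 0)"
        by (intro sum.cong) auto
      also have "\<dots> = X ((j + k) mod int N) j * of_nat N"
        using assms(1) by (subst sum.delta) auto
      finally show ?thesis using X[OF j k] by simp
    qed
    have "(\<Sum>x<N. of_real (\<mu> x) * root_char N (k * int x)) = (\<Sum>x<N. f x * root_char N (k * int x)) / (of_nat N)\<^sup>2"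
      by (simp add: f_mu sum_divide_distrib)
    also have "(\<Sum>x<N. f x * root_char N (k * int x))
        = (\<Sum>j\<in>?I. \<Sum>i\<in>?I. X i j * (\<Sum>x<N. root_char N ((k - i + j) * int x)))"
      unfolding fx sum_distrib_left by (subst sum.swap, intro sum.cong refl, rule sum.swap)
    also have "\<dots> = (\<Sum>j\<in>?I. \<gamma> k * of_nat N)"
      unfolding sum_root_char[OF assms(1)] by (intro sum.cong refl inner)
    also have "\<dots> = \<gamma> k * (of_nat N)\<^sup>2"
      by (simp add: power2_eq_square)
    finally show ?thesis using assms(1) by simp
  qed
  have "of_real (\<Sum>x<N. \<mu> x) = (1 :: complex)"
    using moment[of 0] assms(4) by simp
  then have "(\<Sum>x<N. \<mu> x) = 1" using of_real_eq_1_iff by blast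
  then show ?thesis using that nonneg moment by blast
qed

text \<open>Block \<open>n\<close> is a second copy of block \<open>0\<close>, shifted by
  \<open>N\<close>. Identifying the two closes the chain of blocks to a cycle, on which the cyclic
  diagonals of order at most \<open>d\<close> are constant.\<close>

lemma block_completion_representing_measure:
  assumes "0 < d" "0 < n" and N: "N = n * d"
    and C: "block_completion d \<gamma> (int n) C"
    and periodic: "\<And>m m'. m mod int N = m' mod int N \<Longrightarrow> \<gamma> m = \<gamma> m'"
    and one: "\<gamma> 0 = 1"
  obtains \<mu> :: "nat \<Rightarrow> real" where "\<And>x. 0 \<le> \<mu> x" "(\<Sum>x<N. \<mu> x) = 1"
    and "\<And>k. k \<in> {0..int d} \<Longrightarrow> (\<Sum>x<N. of_real (\<mu> x) * root_char N (k * int x)) = \<gamma> k"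
proof -
  define q where "q i = i div int d" for i
  let ?V = "block_union d {0..int n}"
  have fin: "finite ?V" using assms(1) by (intro finite_block_union) auto
  have Nd: "int N = int n * int d" by (simp add: N)
  have dN: "d \<le> N" using assms(2) by (simp add: N)
  \<comment> \<open>One full period followed by the copy of its first block.\<close>
  have V: "?V = {0..<int N + int d}"
  proof -
    have "0 \<le> i div int d \<longleftrightarrow> 0 \<le> i" for i
      using assms(1) by (simp add: pos_imp_zdiv_nonneg_iff)
    moreover have "i div int d \<le> int n \<longleftrightarrow> i < int N + int d" for i
    proof -
      have "(i - m * int d) div int d = i div int d - m" for m
        using assms(1) div_mult_self1[of "int d" i "- m"] by simp
      from this[of "int n + 1"]
      have "i div int d \<le> int n \<longleftrightarrow> \<not> 0 \<le> (i - (int n + 1) * int d) div int d"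
        by linarith
      also have "\<dots> \<longleftrightarrow> i < (int n + 1) * int d"
        using assms(1) by (simp add: pos_imp_zdiv_nonneg_iff not_le)
      finally show ?thesis by (simp add: Nd algebra_simps)
    qed
    ultimately show ?thesis by (auto simp: block_union_def)
  qed
  have psd: "psd_kernel ?V C"
    and val: "\<And>i j. i \<in> ?V \<Longrightarrow> j \<in> ?V \<Longrightarrow>
      \<bar>q i - q j\<bar> \<le> 1 \<or> {q i, q j} \<subseteq> {0, int n} \<Longrightarrow> C i j = \<gamma> (i - j)"
    using C unfolding block_completion_def q_def by blast+
  \<comment> \<open>A shift by at most the block length reaches at most the next block; this is
    where \<open>d\<close> limits the order of the moments.\<close>
  have q_near: "\<bar>q (j + k) - q j\<bar> \<le> 1" if "k \<in> {0..int d}" for j k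
  proof -
    have "q j \<le> q (j + k)"
      unfolding q_def using that assms(1) by (intro zdiv_mono1) auto
    moreover have "q (j + k) \<le> q (j + int d)"
      unfolding q_def using that assms(1) by (intro zdiv_mono1) auto
    moreover have "q (j + int d) = q j + 1"
      unfolding q_def using assms(1) by simp
    ultimately show ?thesis by linarith
  qed
  \<comment> \<open>The vectors of indices \<open>i\<close> and \<open>i + N\<close> coincide, since their inner products do.\<close>
  have wrap: "C i j = C (i + int N) j" if i: "i \<in> {0..<int d}" and j: "j \<in> ?V" for i j
  proof -
    have iV: "i \<in> ?V" "i + int N \<in> ?V" using i by (auto simp: V)
    have qi: "q i = 0" "q (i + int N) = int n"
      using i assms(1) by (auto simp: q_def Nd)
    let ?v = "\<lambda>l. unit_fun i l - unit_fun (i + int N) l"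
    \<comment> \<open>Here \<open>a - b\<close> is 0, \<open>N\<close> or \<open>- N\<close>, and
      the closing edge between the blocks \<open>0\<close> and \<open>n\<close> prescribes the
      entry.\<close>
    have "C a b = 1" if "a \<in> {i, i + int N}" "b \<in> {i, i + int N}" for a b
    proof -
      have "C a b = \<gamma> (a - b)" using that qi iV by (intro val) auto
      also have "\<dots> = \<gamma> 0"
        by (rule periodic) (use that in \<open>auto simp: zmod_zminus1_eq_if\<close>)
      finally show ?thesis by (simp add: one)
    qed
    then have "kernel_form ?V C ?v ?v = 0"
      by (simp add: kernel_form_diff_left kernel_form_diff_right kernel_form_unit[OF fin] iV)
    then have "kernel_form ?V C (unit_fun j) ?v = 0"
      by (rule psd_kernel_null_orthogonal[OF psd])
    then have "C j i = C j (i + int N)"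
      by (simp add: kernel_form_diff_right kernel_form_unit[OF fin] iV j)
    then show ?thesis
      using psd_kernel_hermitian[OF psd j iV(1)] psd_kernel_hermitian[OF psd j iV(2)] by simp
  qed
  \<comment> \<open>If \<open>j + k\<close> reaches \<open>N\<close>, it lies in block
    \<open>n\<close>, and \<open>wrap\<close> moves it back to the first block.\<close>
  have entry: "C ((j + k) mod int N) j = \<gamma> k" if j: "j \<in> {0..<int N}" and k: "k \<in> {0..int d}" for j k
  proof -
    have jkV: "j + k \<in> ?V" "j \<in> ?V" using j k by (auto simp: V)
    have "C (j + k) j = \<gamma> (j + k - j)"
      using q_near[OF k] by (intro val jkV) auto
    moreover have "C ((j + k) mod int N) j = C (j + k) j"
    proof (cases "j + k < int N")
      case True
      then show ?thesis using j k by simp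
    next
      case False
      then have "(j + k) mod int N = j + k - int N"
        using j k dN mod_pos_pos_trivial[of "j + k - int N" "int N"] by simp
      moreover have "j + k - int N \<in> {0..<int d}" using False j k by auto
      ultimately show ?thesis using wrap[of "j + k - int N" j] jkV(2) by simp
    qed
    ultimately show ?thesis by simp
  qed
  have psdI: "psd_kernel {0..<int N} C"
    by (rule psd_kernel_subset[OF psd fin]) (auto simp: V)
  from circulant_average[where d = d and \<gamma> = \<gamma>, OF _ psdI entry one] assms(1,2) N that
  show ?thesis by (metis nat_0_less_mult_iff)
qed

section \<open>The lift\<close>

lemma mat_adjoint_eq_iff:
  assumes "A \<in> carrier_mat k k"
  shows "mat_adjoint A = A \<longleftrightarrow> (\<forall>i<k. \<forall>j<k. A $$ (j, i) = cnj (A $$ (i, j)))"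
proof -
  have dims: "dim_row (mat_adjoint A) = k" "dim_col (mat_adjoint A) = k"
    using assms by (simp_all add: mat_adjoint_def)
  have entry: "mat_adjoint A $$ (j, i) = cnj (A $$ (i, j))" if "i < k" "j < k" for i j
    using assms that by (simp add: mat_adjoint_def mat_of_rows_index)
  have "mat_adjoint A = A \<longleftrightarrow> (\<forall>i<k. \<forall>j<k. mat_adjoint A $$ (j, i) = A $$ (j, i))"
    using assms dims unfolding mat_eq_iff by auto
  also have "\<dots> \<longleftrightarrow> (\<forall>i<k. \<forall>j<k. A $$ (j, i) = cnj (A $$ (i, j)))"
    by (intro all_cong1 imp_cong refl, simp only: entry) (rule eq_commute)
  finally show ?thesis .
qed

lemma hermitian_matsI:
  assumes "A \<in> carrier_mat k k" "\<And>i j. i < k \<Longrightarrow> j < k \<Longrightarrow> A $$ (j, i) = cnj (A $$ (i, j))"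
  shows "A \<in> hermitian_mats k"
  unfolding hermitian_mats_def mem_Collect_eq mat_adjoint_eq_iff[OF assms(1)]
  by (intro conjI allI impI assms)

text \<open>The scalar product conjugates the coordinate paired with the row index,
  \<open>kernel_form\<close> the one paired with the column index; so vectors and functions
  correspond by conjugation.\<close>

lemma psd_mats_iff_psd_kernel:
  assumes A: "A \<in> carrier_mat k k"
  shows "A \<in> psd_mats k \<longleftrightarrow> psd_kernel {..<k} (\<lambda>i j. A $$ (i, j))"
proof -
  have form: "(A *\<^sub>v v) \<bullet>c v = kernel_form {..<k} (\<lambda>i j. A $$ (i, j)) (\<lambda>i. cnj (v $ i)) (\<lambda>i. cnj (v $ i))"
    if "v \<in> carrier_vec k" for v
    using A that
    by (simp add: scalar_prod_def kernel_form_def sum_distrib_left sum_distrib_right mult_ac lessThan_atLeast0)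
  have "(\<forall>v\<in>carrier_vec k. 0 \<le> Re ((A *\<^sub>v v) \<bullet>c v)) \<longleftrightarrow>
      (\<forall>x. 0 \<le> Re (kernel_form {..<k} (\<lambda>i j. A $$ (i, j)) x x))" (is "?L \<longleftrightarrow> ?R")
  proof
    assume L: ?L
    show ?R
    proof
      fix x
      define v where "v = vec k (\<lambda>i. cnj (x i))"
      have "kernel_form {..<k} (\<lambda>i j. A $$ (i, j)) (\<lambda>i. cnj (v $ i)) (\<lambda>i. cnj (v $ i))
          = kernel_form {..<k} (\<lambda>i j. A $$ (i, j)) x x"
        by (simp add: kernel_form_def v_def)
      then show "0 \<le> Re (kernel_form {..<k} (\<lambda>i j. A $$ (i, j)) x x)"
        using L form[of v] by (metis v_def vec_carrier)
    qed
  qed (simp add: form)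
  then show ?thesis
    using A by (simp add: psd_mats_def hermitian_mats_def mat_adjoint_eq_iff psd_kernel_def Ball_def)
qed

text \<open>For \<open>e\<close> the integer part of \<open>log 2 n\<close>, these represent
  \<open>clique_offsets n\<close> modulo \<open>n\<close>: the remainders for \<open>i = 0\<close>
  and \<open>i = 1\<close> are 0 or 1, and those for \<open>i > e\<close> equal \<open>n\<close>.
  Starting with 0, 1 puts the integers \<open>0..d\<close> into the first rows of the lift in
  order.\<close>

definition offset_list :: "nat \<Rightarrow> nat \<Rightarrow> int list"
  where "offset_list n e = [0, 1] @ map (\<lambda>i. 2 ^ i) [1..<Suc e] @ map (\<lambda>i. int (n mod 2 ^ i)) [2..<Suc e]"

lemma length_offset_list: "1 \<le> e \<Longrightarrow> length (offset_list n e) = 2 * e + 1"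
  by (simp add: offset_list_def, arith)

text \<open>Congruence modulo \<open>n\<close> is enough, as offsets count blocks of length
  \<open>d\<close> and the moments will have period \<open>n * d\<close>.\<close>

lemma clique_offsets_subset:
  assumes e: "2 ^ e \<le> n" "n < 2 ^ Suc e" and s: "s \<in> clique_offsets n"
  shows "\<exists>t\<in>set (offset_list n e). t mod int n = s mod int n"
proof -
  consider "s = 0" | i where "s = 2 ^ i" "2 ^ i \<le> n" | i where "s = int (n mod 2 ^ i)"
    using s unfolding clique_offsets_def by blast
  then show ?thesis
  proof cases
    case 1
    then show ?thesis by (auto simp: offset_list_def)
  next
    case 2
    then have "(2::nat) ^ i < 2 ^ Suc e" using e by linarith
    then have "i < Suc e" by (rule power_less_imp_less_exp[rotated]) simp
    have "s \<in> set (offset_list n e)"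
    proof (cases "i = 0")
      case True
      then show ?thesis using 2(1) by (simp add: offset_list_def)
    next
      case False
      then have "i \<in> set [1..<Suc e]"
        using \<open>i < Suc e\<close> unfolding set_upt atLeastLessThan_iff by linarith
      then have "s \<in> set (map (\<lambda>i. 2 ^ i) [1..<Suc e])"
        unfolding 2(1) set_map by (rule imageI)
      then show ?thesis unfolding offset_list_def set_append by blast
    qed
    then show ?thesis by blast
  next
    case 3
    consider "i = 0" | "i = 1" | "2 \<le> i" "i \<le> e" | "Suc e \<le> i" by linarith
    then show ?thesis
    proof cases
      case 2
      then show ?thesis using 3 by (auto simp: offset_list_def mod2_eq_if)
    next
      case 4
      \<comment> \<open>Beyond the top digit the remainder is \<open>n\<close> itself, represented
        by the offset 0.\<close>
      then have "n < 2 ^ i"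
        using e(2) power_increasing[of "Suc e" i "2::nat"] by linarith
      then show ?thesis using 3 by (auto simp: offset_list_def)
    next
      case 3
      then have "i \<in> set [2..<Suc e]" unfolding set_upt atLeastLessThan_iff by linarith
      then have "s \<in> set (map (\<lambda>i. int (n mod 2 ^ i)) [2..<Suc e])"
        unfolding \<open>s = int (n mod 2 ^ i)\<close> set_map by (rule imageI)
      then have "s \<in> set (offset_list n e)" unfolding offset_list_def set_append by blast
      then show ?thesis by blast
    qed (use 3 in \<open>auto simp: offset_list_def\<close>)
  qed
qed

section \<open>Rows of the lift and the residues they represent\<close>

definition row_shift :: "nat \<Rightarrow> int list \<Rightarrow> nat \<Rightarrow> int"
  where "row_shift d \<tau> a = \<tau> ! (a div d) * int d + int (a mod d)"

text \<open>Moving an integer by a multiple of \<open>n\<close> blocks keeps its residue modulo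
  \<open>n * d\<close>, and each offset in the list contributes a whole block of rows.\<close>

lemma row_shift_covers:
  assumes "0 < d" "t \<in> set \<tau>" "t mod int n = i div int d mod int n"
  shows "\<exists>a<length \<tau> * d. row_shift d \<tau> a mod int (n * d) = i mod int (n * d)"
proof -
  obtain p where p: "p < length \<tau>" "\<tau> ! p = t"
    using assms(2) by (metis in_set_conv_nth)
  define r where "r = nat (i mod int d)"
  have r: "r < d" "int r = i mod int d"
    using assms(1) by (auto simp: r_def nat_less_iff)
  have "p * d + r < length \<tau> * d"
  proof -
    have "p * d + r < Suc p * d" using r by simp
    also have "\<dots> \<le> length \<tau> * d" using p by (intro mult_right_mono) auto
    finally show ?thesis .
  qed
  moreover have "row_shift d \<tau> (p * d + r) = t * int d + i mod int d"
    using p r by (simp add: row_shift_def)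
  moreover have "(t * int d + i mod int d) mod int (n * d) = i mod int (n * d)"
  proof -
    have "int n dvd t - i div int d" using assms(3) by (simp add: mod_eq_dvd_iff)
    then have "int (n * d) dvd (t - i div int d) * int d" by (simp add: mult_dvd_mono)
    moreover have "(t - i div int d) * int d = t * int d + i mod int d - i"
      using div_mult_mod_eq[of i "int d"] by (simp add: algebra_simps)
    ultimately show ?thesis by (simp add: mod_eq_dvd_iff)
  qed
  ultimately show ?thesis by metis
qed

text \<open>The conditions on moments that are affine over the reals; positivity is left to the
  semidefinite cone.\<close>

definition character_moments :: "nat \<Rightarrow> (int \<Rightarrow> complex) \<Rightarrow> bool"
  where "character_moments N \<gamma> \<longleftrightarrow> (\<forall>m m'. m mod int N = m' mod int N \<longrightarrow> \<gamma> m = \<gamma> m') \<and>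
    (\<forall>m. \<gamma> (- m) = cnj (\<gamma> m)) \<and> \<gamma> 0 = 1"

section \<open>Moment matrices and the readout map\<close>

definition moment_mat :: "nat \<Rightarrow> (nat \<Rightarrow> int) \<Rightarrow> (int \<Rightarrow> complex) \<Rightarrow> complex mat"
  where "moment_mat k t \<gamma> = mat k k (\<lambda>(a, b). \<gamma> (t a - t b))"

text \<open>If \<open>t m = m\<close> for \<open>m \<le> d\<close>, column 0 of a moment matrix
  holds the moment of order \<open>m\<close> in row \<open>m\<close>. Its real and imaginary parts
  match the cosine and sine coordinates.\<close>

definition readout :: "complex mat \<Rightarrow> real ^ 'n::{finite,linorder}"
  where "readout A = (\<chi> i. let m = coord_pos i div 2 + 1
     in if even (coord_pos i) then Re (A $$ (m, 0)) else Im (A $$ (m, 0)))"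

lemma coord_pos_less: "coord_pos (i :: 'n::{finite,linorder}) < CARD('n)"
  unfolding coord_pos_def by (rule psubset_card_mono) auto

lemma moment_mat_carrier [simp]: "moment_mat k t \<gamma> \<in> carrier_mat k k"
  by (simp add: moment_mat_def)

lemma moment_mat_index [simp]: "a < k \<Longrightarrow> b < k \<Longrightarrow> moment_mat k t \<gamma> $$ (a, b) = \<gamma> (t a - t b)"
  by (simp add: moment_mat_def)

lemma hermitian_affine_moment_mats:
  "hermitian_affine k {moment_mat k t \<gamma> | \<gamma>. character_moments N \<gamma>}"
  unfolding hermitian_affine_def
proof (intro conjI ballI allI impI subsetI)
  fix A assume "A \<in> {moment_mat k t \<gamma> | \<gamma>. character_moments N \<gamma>}"
  then obtain \<gamma> where A: "A = moment_mat k t \<gamma>" and \<gamma>: "\<And>m. \<gamma> (- m) = cnj (\<gamma> m)"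
    by (auto simp: character_moments_def)
  show "A \<in> hermitian_mats k"
    unfolding A
  proof (rule hermitian_matsI[OF moment_mat_carrier])
    show "moment_mat k t \<gamma> $$ (j, i) = cnj (moment_mat k t \<gamma> $$ (i, j))" if "i < k" "j < k" for i j
      using that \<gamma>[of "t i - t j"] by simp
  qed
next
  fix A B and u v :: real
  assume A: "A \<in> {moment_mat k t \<gamma> | \<gamma>. character_moments N \<gamma>}"
    and B: "B \<in> {moment_mat k t \<gamma> | \<gamma>. character_moments N \<gamma>}" and uv: "u + v = 1"
  from A obtain \<gamma> where \<gamma>: "A = moment_mat k t \<gamma>" "character_moments N \<gamma>" by blast
  from B obtain \<delta> where \<delta>: "B = moment_mat k t \<delta>" "character_moments N \<delta>" by blast
  have "of_real u \<cdot>\<^sub>m A + of_real v \<cdot>\<^sub>m B = moment_mat k t (\<lambda>m. of_real u * \<gamma> m + of_real v * \<delta> m)"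
    unfolding \<gamma>(1) \<delta>(1) by (intro eq_matI) (auto simp: moment_mat_def)
  moreover have "character_moments N (\<lambda>m. of_real u * \<gamma> m + of_real v * \<delta> m)"
    unfolding character_moments_def
  proof (intro conjI allI impI)
    fix m m' assume "m mod int N = m' mod int N"
    then have "\<gamma> m = \<gamma> m'" "\<delta> m = \<delta> m'"
      using \<gamma>(2) \<delta>(2) unfolding character_moments_def by blast+
    then show "of_real u * \<gamma> m + of_real v * \<delta> m = of_real u * \<gamma> m' + of_real v * \<delta> m'"
      by simp
  next
    fix m
    have "\<gamma> (- m) = cnj (\<gamma> m)" "\<delta> (- m) = cnj (\<delta> m)"
      using \<gamma>(2) \<delta>(2) unfolding character_moments_def by blast+
    then show "of_real u * \<gamma> (- m) + of_real v * \<delta> (- m) = cnj (of_real u * \<gamma> m + of_real v * \<delta> m)"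
      by simp
  next
    have "complex_of_real u + of_real v = 1" using uv by (metis of_real_1 of_real_add)
    then show "of_real u * \<gamma> 0 + of_real v * \<delta> 0 = 1"
      using \<gamma>(2) \<delta>(2) by (simp add: character_moments_def)
  qed
  ultimately show "of_real u \<cdot>\<^sub>m A + of_real v \<cdot>\<^sub>m B \<in> {moment_mat k t \<gamma> | \<gamma>. character_moments N \<gamma>}"
    by blast
qed

lemma real_linear_readout:
  assumes "CARD('n) = 2 * d" "d < k"
  shows "real_linear_on_hermitian k (readout :: complex mat \<Rightarrow> real ^ 'n::{finite,linorder})"
proof -
  \<comment> \<open>Sums and multiples of matrices are known entrywise only inside their dimensions,
    so the rows read must lie below \<open>k\<close>.\<close>
  have idx: "coord_pos i div 2 + 1 < k" for i :: 'n
    using coord_pos_less[of i] assms by linarith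
  have "0 < k" using assms(2) by simp
  have "readout (A + B) = (readout A + readout B :: real ^ 'n::{finite,linorder})"
    if "A \<in> carrier_mat k k" "B \<in> carrier_mat k k" for A B
    using that idx \<open>0 < k\<close> by (simp add: Finite_Cartesian_Product.vec_eq_iff readout_def Let_def)
  moreover have "readout (of_real c \<cdot>\<^sub>m A) = (c *\<^sub>R readout A :: real ^ 'n::{finite,linorder})"
    if "A \<in> carrier_mat k k" for A c
    using that idx \<open>0 < k\<close> by (simp add: Finite_Cartesian_Product.vec_eq_iff readout_def Let_def)
  ultimately show ?thesis
    by (simp add: real_linear_on_hermitian_def hermitian_mats_def)
qed

text \<open>This allows the inclusion of the polytope in the projected slice to be checked at the
  nodes alone.\<close>

lemma convex_linear_image_psd_mats:
  assumes "real_linear_on_hermitian k \<pi>" "hermitian_affine k L"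
  shows "convex (\<pi> ` (psd_mats k \<inter> L))"
  unfolding convex_def
proof (intro ballI allI impI)
  fix x y and u v :: real
  assume "x \<in> \<pi> ` (psd_mats k \<inter> L)" "y \<in> \<pi> ` (psd_mats k \<inter> L)" and uv: "0 \<le> u" "0 \<le> v" "u + v = 1"
  then obtain A B where A: "A \<in> psd_mats k" "A \<in> L" "x = \<pi> A" and B: "B \<in> psd_mats k" "B \<in> L" "y = \<pi> B"
    by blast
  let ?D = "complex_of_real u \<cdot>\<^sub>m A + complex_of_real v \<cdot>\<^sub>m B"
  have carr: "A \<in> carrier_mat k k" "B \<in> carrier_mat k k"
    using A(1) B(1) by (auto simp: psd_mats_def hermitian_mats_def)
  have D: "?D \<in> L" using assms(2) A(2) B(2) uv(3) unfolding hermitian_affine_def by blast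
  have "psd_kernel {..<k} (\<lambda>i j. ?D $$ (i, j))"
  proof -
    have "psd_kernel {..<k} (\<lambda>i j. A $$ (i, j))" "psd_kernel {..<k} (\<lambda>i j. B $$ (i, j))"
      using carr A(1) B(1) psd_mats_iff_psd_kernel by blast+
    then have "psd_kernel {..<k} (\<lambda>i j. of_real u * A $$ (i, j) + of_real v * B $$ (i, j))"
      by (intro psd_kernel_add psd_kernel_scale uv)
    then show ?thesis
      by (rule psd_kernel_cong[THEN iffD1, rotated]) (use carr in auto)
  qed
  then have "?D \<in> psd_mats k"
    using carr psd_mats_iff_psd_kernel[of ?D k] by auto
  moreover have "\<pi> ?D = u *\<^sub>R x + v *\<^sub>R y"
  proof -
    \<comment> \<open>The map \<open>\<pi>\<close> is additive only on Hermitian matrices, so both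
      scaled summands must be Hermitian.\<close>
    have herm: "complex_of_real w \<cdot>\<^sub>m M \<in> hermitian_mats k" if "M \<in> hermitian_mats k" for M w
    proof -
      have M: "M \<in> carrier_mat k k" and adj: "mat_adjoint M = M"
        using that by (auto simp: hermitian_mats_def)
      have h: "M $$ (j, i) = cnj (M $$ (i, j))" if "i < k" "j < k" for i j
        using adj that unfolding mat_adjoint_eq_iff[OF M] by blast
      show ?thesis
      proof (rule hermitian_matsI)
        show "(complex_of_real w \<cdot>\<^sub>m M) $$ (j, i) = cnj ((complex_of_real w \<cdot>\<^sub>m M) $$ (i, j))"
          if "i < k" "j < k" for i j
          using h[OF that] that M by simp
      qed (use M in simp)
    qed
    have AB: "A \<in> hermitian_mats k" "B \<in> hermitian_mats k"
      using A(1) B(1) by (auto simp: psd_mats_def)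
    show ?thesis
      using assms(1) herm[OF AB(1), of u] herm[OF AB(2), of v] AB A(3) B(3)
      unfolding real_linear_on_hermitian_def by metis
  qed
  ultimately show "u *\<^sub>R x + v *\<^sub>R y \<in> \<pi> ` (psd_mats k \<inter> L)"
    using D by (metis IntI imageI)
qed

section \<open>Characters as points of the lift\<close>

lemma character_moments_root_char:
  assumes "0 < N"
  shows "character_moments N (\<lambda>m. root_char N (m * int x))"
  unfolding character_moments_def
proof (intro conjI allI impI)
  fix m m' assume "m mod int N = m' mod int N"
  then have "root_char N m = root_char N m'" by (rule root_char_mod_cong[OF assms])
  then show "root_char N (m * int x) = root_char N (m' * int x)"
    by (simp add: root_char_mult_nat)
qed (simp_all add: root_char_mult_nat root_char_uminus)

text \<open>A character is multiplicative, so its moment matrix has rank at most one: it is pulled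
  back from the one-point kernel with entry 1.\<close>

lemma psd_moment_mat_root_char:
  "moment_mat k t (\<lambda>m. root_char N (m * int x)) \<in> psd_mats k"
proof -
  have "psd_kernel {()} (\<lambda>_ _. 1)"
    by (simp add: psd_kernel_def kernel_form_def)
  from psd_kernel_linear_pullback[OF this, of "{..<k}" "\<lambda>a _. root_char N (t a * int x)"]
  have "psd_kernel {..<k} (\<lambda>a b. root_char N ((t a - t b) * int x))"
    by (simp add: kernel_form_def left_diff_distrib root_char_diff)
  then show ?thesis
    unfolding psd_mats_iff_psd_kernel[OF moment_mat_carrier]
    by (rule psd_kernel_cong[THEN iffD1, rotated]) auto
qed

text \<open>The readout is linear in \<open>\<gamma>\<close>. A singleton \<open>X\<close> serves
  for the nodes, \<open>{..<N}\<close> for the representing measure.\<close>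

lemma readout_moment_mat:
  assumes "CARD('n) = 2 * d" "d < k"
    and t: "\<And>m. m \<le> d \<Longrightarrow> t m = int m"
    and \<gamma>: "\<And>m. m \<in> {0..int d} \<Longrightarrow> (\<Sum>x\<in>X. of_real (\<mu> x) * root_char N (m * int x)) = \<gamma> m"
  shows "readout (moment_mat k t \<gamma>)
    = (\<Sum>x\<in>X. \<mu> x *\<^sub>R trig_moment (2 * pi * real x / real N) :: real ^ 'n::{finite,linorder})"
proof (subst Finite_Cartesian_Product.vec_eq_iff, intro allI)
  fix i :: 'n
  define m where "m = coord_pos i div 2 + 1"
  have m: "m \<le> d" using coord_pos_less[of i] assms(1) unfolding m_def by linarith
  have "root_char N (int m * int x) = cis (real m * (2 * pi * real x / real N))" for x
    by (simp add: root_char_def mult_ac)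
  then have "moment_mat k t \<gamma> $$ (m, 0)
      = (\<Sum>x\<in>X. of_real (\<mu> x) * cis (real m * (2 * pi * real x / real N)))"
    using m assms(2) t[of m] t[of 0] \<gamma>[of "int m"] by simp
  then show "readout (moment_mat k t \<gamma>) $ i
      = (\<Sum>x\<in>X. \<mu> x *\<^sub>R trig_moment (2 * pi * real x / real N) :: real ^ 'n::{finite,linorder}) $ i"
    by (simp only: readout_def trig_moment_def Let_def vec_lambda_beta sum_component
        vector_scaleR_component m_def[symmetric]) simp
qed

section \<open>Size count and the two inclusions\<close>

theorem mainTheorem6:
  fixes N d :: nat
  assumes "0 < N" and "0 < d" and "d dvd N" and "d < N"
    and "CARD('n) = 2 * d"
  shows "\<exists>k::nat. real k \<le> 3 * real d * log 2 (real N / real d) \<and>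
           has_hermitian_psd_lift k (trig_cyclic_polytope N :: (real ^ 'n::{finite,linorder}) set)"
proof -
  obtain n where N: "N = n * d" using assms(3) by (metis dvdE mult.commute)
  have "1 * d < n * d" using assms(4) N by simp
  then have n: "2 \<le> n" unfolding mult_less_cancel2 by simp
  obtain e where e: "2 ^ e \<le> n" "n < 2 ^ Suc e"
    using ex_power_ivl1[of 2 n] n by auto
  \<comment> \<open>Positivity of \<open>e\<close> yields \<open>2 * e + 1 \<le> 3 * e\<close> in
    the size bound.\<close>
  have e1: "1 \<le> e" using e n by (cases e) auto
  define \<tau> where "\<tau> = offset_list n e"
  define t where "t = row_shift d \<tau>"
  define k where "k = length \<tau> * d"
  define L where "L = {moment_mat k t \<gamma> | \<gamma>. character_moments N \<gamma>}"
  let ?\<pi> = "readout :: complex mat \<Rightarrow> real ^ 'n::{finite,linorder}"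
  have len: "length \<tau> = 2 * e + 1" unfolding \<tau>_def by (rule length_offset_list[OF e1])
  have k: "d < k" using e1 assms(2) by (simp add: k_def len)
  \<comment> \<open>Rows below \<open>d\<close> fill block 0, and row \<open>d\<close> opens block
    1.\<close>
  have t: "t m = int m" if "m \<le> d" for m
  proof (cases "m = d")
    case True
    then show ?thesis using assms(2) by (simp add: t_def row_shift_def \<tau>_def offset_list_def)
  next
    case False
    then show ?thesis using that by (simp add: t_def row_shift_def \<tau>_def offset_list_def)
  qed
  have "real k \<le> 3 * real d * log 2 (real N / real d)"
  proof -
    have "real e \<le> log 2 (real n)"
      using e(1) n by (simp add: le_log_iff powr_realpow)
    moreover have "real k \<le> 3 * real d * real e"
    proof -
      have "(2 * e + 1) * d \<le> 3 * e * d" using e1 by (intro mult_right_mono) auto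
      then have "real ((2 * e + 1) * d) \<le> real (3 * e * d)" by (rule of_nat_mono)
      then show ?thesis by (simp add: k_def len mult_ac)
    qed
    moreover have "real N / real d = real n" using assms(2) by (simp add: N)
    ultimately show ?thesis
      using mult_left_mono[of "real e" "log 2 (real n)" "3 * real d"] by simp
  qed
  moreover have lin: "real_linear_on_hermitian k ?\<pi>"
    by (rule real_linear_readout[OF assms(5) k])
  moreover have aff: "hermitian_affine k L"
    unfolding L_def by (rule hermitian_affine_moment_mats)
  moreover have "trig_cyclic_polytope N = ?\<pi> ` (psd_mats k \<inter> L)"
  proof
    show "trig_cyclic_polytope N \<subseteq> ?\<pi> ` (psd_mats k \<inter> L)"
      unfolding trig_cyclic_polytope_def
    proof (rule hull_minimal)
      show "convex (?\<pi> ` (psd_mats k \<inter> L))" by (rule convex_linear_image_psd_mats[OF lin aff])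
      show "(\<lambda>x. trig_moment (2 * pi * real x / real N)) ` {0..<N} \<subseteq> ?\<pi> ` (psd_mats k \<inter> L)"
      proof (rule image_subsetI)
        fix x
        let ?A = "moment_mat k t (\<lambda>m. root_char N (m * int x))"
        have "?\<pi> ?A = trig_moment (2 * pi * real x / real N)"
          using readout_moment_mat[OF assms(5) k t, where X = "{x}" and \<mu> = "\<lambda>_. 1"] by simp
        moreover have "?A \<in> psd_mats k \<inter> L"
          using psd_moment_mat_root_char character_moments_root_char[OF assms(1)]
          unfolding L_def by blast
        ultimately show "trig_moment (2 * pi * real x / real N) \<in> ?\<pi> ` (psd_mats k \<inter> L)"
          by (metis imageI)
      qed
    qed
    show "?\<pi> ` (psd_mats k \<inter> L) \<subseteq> trig_cyclic_polytope N"
    proof (rule image_subsetI)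
      fix A assume "A \<in> psd_mats k \<inter> L"
      then obtain \<gamma> where A: "A = moment_mat k t \<gamma>" and mom: "character_moments N \<gamma>"
        and "moment_mat k t \<gamma> \<in> psd_mats k" by (auto simp: L_def)
      then have "psd_kernel {..<k} (\<lambda>a b. moment_mat k t \<gamma> $$ (a, b))"
        using psd_mats_iff_psd_kernel moment_mat_carrier by blast
      then have psd: "psd_kernel {..<k} (\<lambda>a b. \<gamma> (t a - t b))"
        by (rule psd_kernel_cong[THEN iffD1, rotated]) auto
      have periodic: "\<gamma> m = \<gamma> m'" if "m mod int N = m' mod int N" for m m'
        using mom that unfolding character_moments_def by blast
      have one: "\<gamma> 0 = 1" using mom by (simp add: character_moments_def)
      \<comment> \<open>Each triangle of blocks is visible in the matrix modulo \<open>N\<close>: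
        \<open>c\<close> picks rows with the right residues, and periodicity turns the pulled back
        kernel into \<open>\<gamma> (i - j)\<close>.\<close>
      have clique: "psd_kernel (block_union d {0, a, b}) (\<lambda>i j. \<gamma> (i - j))"
        if ab: "{a, b} \<subseteq> clique_offsets n" for a b
      proof -
        have "\<exists>c<k. t c mod int N = i mod int N" if "i \<in> block_union d {0, a, b}" for i
        proof -
          have "0 \<in> clique_offsets n" by (simp add: clique_offsets_def)
          then have "i div int d \<in> clique_offsets n"
            using that ab by (auto simp: block_union_def)
          then obtain s where "s \<in> set \<tau>" "s mod int n = i div int d mod int n"
            using clique_offsets_subset[OF e] unfolding \<tau>_def by blast
          then show ?thesis
            using row_shift_covers[OF assms(2)] unfolding k_def t_def N by blast
        qed
        then obtain c where c: "\<And>i. i \<in> block_union d {0, a, b} \<Longrightarrow> c i < k \<and> t (c i) mod int N = i mod int N"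
          by metis
        have "psd_kernel (block_union d {0, a, b}) (\<lambda>i j. \<gamma> (t (c i) - t (c j)))"
          by (rule psd_kernel_pullback[OF psd]) (use c in auto)
        moreover have "\<gamma> (t (c i) - t (c j)) = \<gamma> (i - j)"
          if "i \<in> block_union d {0, a, b}" "j \<in> block_union d {0, a, b}" for i j
          using c[OF that(1)] c[OF that(2)] by (intro periodic mod_diff_cong) auto
        ultimately show ?thesis by (rule psd_kernel_cong[THEN iffD1, rotated])
      qed
      have n0: "0 < n" using n by simp
      obtain C where C: "block_completion d \<gamma> (int n) C"
        using block_completion_exists[OF assms(2) n0 clique] by blast
      obtain \<mu> :: "nat \<Rightarrow> real" where \<mu>: "\<And>x. 0 \<le> \<mu> x" "(\<Sum>x<N. \<mu> x) = 1"
        "\<And>k. k \<in> {0..int d} \<Longrightarrow> (\<Sum>x<N. of_real (\<mu> x) * root_char N (k * int x)) = \<gamma> k"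
        using block_completion_representing_measure[OF assms(2) n0 N C periodic one] by blast
      have "?\<pi> A = (\<Sum>x<N. \<mu> x *\<^sub>R trig_moment (2 * pi * real x / real N))"
        unfolding A by (rule readout_moment_mat[OF assms(5) k t \<mu>(3)])
      also have "\<dots> \<in> trig_cyclic_polytope N"
        unfolding trig_cyclic_polytope_def
        by (rule convex_sum) (use \<mu>(1,2) in \<open>auto intro!: hull_inc\<close>)
      finally show "?\<pi> A \<in> trig_cyclic_polytope N" .
    qed
  qed
  ultimately show ?thesis unfolding has_hermitian_psd_lift_def by blast
qed

end
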